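(* The ideal $\mathcal{G}_{\mathrm{fc}}$ of graphs on $\omega$ with finite chromatic number contains no cotowers.
   Context: $A\subseteq^* B$ means that $A\setminus B$ is finite. Ideals on a countably infinite set $\Omega$ are assumed to be proper and to contain all finite subsets of $\Omega$. A tower on $\Omega$ is a sequence $(T_\alpha)_{\alpha<\kappa}$ of infinite subsets of $\Omega$, with $\kappa$ a cardinal, such that $T_\beta\subseteq^* T_\alpha$ whenever $\alpha\le\beta<\kappa$, and which has no pseudointersection, i.e. there is no infinite $X\subseteq\Omega$ with $X\subseteq^* T_\alpha$ for all $\alpha<\kappa$. A cotower in an ideal $\mathcal{I}$ on $\Omega$ is a sequence $(A_\alpha)_{\alpha<\kappa}$ of elements of $\mathcal{I}$ such that $(\Omega\setminus A_\alpha)_{\alpha<\kappa}$ is a tower. $[\omega]^2$ is the set of two-element subsets of $\omega$, and $\chi(\omega,E)$ is the chromatic number of the graph with vertex set $\omega$ and edge set $E$. The ideal $\mathcal{G}_{\mathrm{fc}}$, on the countable set $[\omega]^2$, is $\mathcal{G}_{\mathrm{fc}}=\{E\subseteq[\omega]^2:\chi(\omega,E)<\omega\}$. *)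

theory Defs
  imports Main "HOL-Library.Extended_Nat" "HOL-Library.Ramsey" "HOL-Library.Nat_Bijection"
begin

definition almost_subset :: "'a set \<Rightarrow> 'a set \<Rightarrow> bool" (infix "\<subseteq>*" 50) where
  "A \<subseteq>* B \<longleftrightarrow> finite (A - B)"

definition ideal_on :: "'a set \<Rightarrow> 'a set set \<Rightarrow> bool" where
  "ideal_on \<Omega> I \<longleftrightarrow>
     I \<subseteq> Pow \<Omega> \<and> \<Omega> \<notin> I \<and>
     (\<forall>A. A \<subseteq> \<Omega> \<and> finite A \<longrightarrow> A \<in> I) \<and>
     (\<forall>A\<in>I. \<forall>B. B \<subseteq> A \<longrightarrow> B \<in> I) \<and>
     (\<forall>A\<in>I. \<forall>B\<in>I. A \<union> B \<in> I)"

text \<open>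
  A cardinal \<open>\<kappa>\<close> is represented, as in the library, by a cardinal order: a well-order whose
  order type is an initial ordinal. The indices \<open>\<alpha> < \<kappa>\<close> are the elements of \<open>Field \<kappa>\<close>, and
  \<open>(\<alpha>, \<beta>) \<in> \<kappa>\<close> means \<open>\<alpha> \<le> \<beta>\<close>. Values of a sequence outside \<open>Field \<kappa>\<close> are irrelevant.
\<close>

definition pseudointersection :: "'a set \<Rightarrow> 'k rel \<Rightarrow> ('k \<Rightarrow> 'a set) \<Rightarrow> 'a set \<Rightarrow> bool" where
  "pseudointersection \<Omega> \<kappa> T X \<longleftrightarrow>
     X \<subseteq> \<Omega> \<and> infinite X \<and> (\<forall>\<alpha>\<in>Field \<kappa>. X \<subseteq>* T \<alpha>)"

definition tower :: "'a set \<Rightarrow> 'k rel \<Rightarrow> ('k \<Rightarrow> 'a set) \<Rightarrow> bool" where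
  "tower \<Omega> \<kappa> T \<longleftrightarrow>
     Card_order \<kappa> \<and>
     (\<forall>\<alpha>\<in>Field \<kappa>. T \<alpha> \<subseteq> \<Omega> \<and> infinite (T \<alpha>)) \<and>
     (\<forall>\<alpha> \<beta>. (\<alpha>, \<beta>) \<in> \<kappa> \<longrightarrow> T \<beta> \<subseteq>* T \<alpha>) \<and>
     (\<nexists>X. pseudointersection \<Omega> \<kappa> T X)"

definition cotower :: "'a set \<Rightarrow> 'a set set \<Rightarrow> 'k rel \<Rightarrow> ('k \<Rightarrow> 'a set) \<Rightarrow> bool" where
  "cotower \<Omega> I \<kappa> A \<longleftrightarrow>
     (\<forall>\<alpha>\<in>Field \<kappa>. A \<alpha> \<in> I) \<and> tower \<Omega> \<kappa> (\<lambda>\<alpha>. \<Omega> - A \<alpha>)"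

definition proper_colouring :: "'a set \<Rightarrow> 'a set set \<Rightarrow> ('a \<Rightarrow> 'c) \<Rightarrow> bool" where
  "proper_colouring V E c \<longleftrightarrow> (\<forall>u\<in>V. \<forall>v\<in>V. {u, v} \<in> E \<longrightarrow> c u \<noteq> c v)"

text \<open>
  The infimum of the empty set is \<open>\<infinity>\<close>. On a countable vertex set this loses nothing: a
  simple graph without finite colouring has chromatic number \<open>\<aleph>\<^sub>0\<close>.
\<close>

definition chromatic_number :: "'a set \<Rightarrow> 'a set set \<Rightarrow> enat" where
  "chromatic_number V E =
     Inf {enat k | k. \<exists>c :: 'a \<Rightarrow> nat. c ` V \<subseteq> {..<k} \<and> proper_colouring V E c}"

definition G_fc :: "nat set set set" where
  "G_fc = {E. E \<subseteq> [UNIV]\<^bsup>2\<^esup> \<and> chromatic_number UNIV E < \<infinity>}"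

lemma chromatic_number_finite_iff:
  "chromatic_number V E < \<infinity> \<longleftrightarrow>
     (\<exists>(c :: 'a \<Rightarrow> nat) k. c ` V \<subseteq> {..<k} \<and> proper_colouring V E c)"
proof -
  have "Inf S < \<infinity> \<longleftrightarrow> (\<exists>x\<in>S. x < \<infinity>)" for S :: "enat set"
    by (rule Inf_less_iff)
  then show ?thesis unfolding chromatic_number_def by auto
qed

lemma G_fc_iff:
  "E \<in> G_fc \<longleftrightarrow> E \<subseteq> [UNIV]\<^bsup>2\<^esup> \<and>
     (\<exists>(c :: nat \<Rightarrow> nat) k. range c \<subseteq> {..<k} \<and> proper_colouring UNIV E c)"
  by (simp only: G_fc_def mem_Collect_eq chromatic_number_finite_iff)

lemma ideal_on_G_fc: "ideal_on ([UNIV]\<^bsup>2\<^esup>) G_fc"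
  unfolding ideal_on_def
proof (intro conjI allI ballI impI)
  show "G_fc \<subseteq> Pow ([UNIV]\<^bsup>2\<^esup>)" by (auto simp: G_fc_def)
next
  show "[UNIV]\<^bsup>2\<^esup> \<notin> G_fc"
  proof
    assume "[UNIV]\<^bsup>2\<^esup> \<in> G_fc"
    then obtain c :: "nat \<Rightarrow> nat" and k
      where c: "range c \<subseteq> {..<k}" "proper_colouring UNIV ([UNIV]\<^bsup>2\<^esup>) c"
      by (auto simp: G_fc_iff)
    have "inj c"
    proof (rule injI, rule ccontr)
      fix u v assume "c u = c v" "u \<noteq> v"
      moreover from \<open>u \<noteq> v\<close> have "{u, v} \<in> [UNIV]\<^bsup>2\<^esup>" by (simp add: nsets_def)
      ultimately show False using c(2) by (auto simp: proper_colouring_def)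
    qed
    moreover have "finite (range c)" using c(1) finite_subset by blast
    ultimately show False using finite_imageD by blast
  qed
next
  fix E :: "nat set set" assume E: "E \<subseteq> [UNIV]\<^bsup>2\<^esup> \<and> finite E"
  then have "finite (\<Union>E)" by (auto simp: nsets_def)
  then obtain m where m: "\<forall>x\<in>\<Union>E. x < m" using finite_nat_set_iff_bounded[of "\<Union>E"] by blast
  have "u \<noteq> v" if "{u, v} \<in> E" for u v
    using that E by (auto simp: nsets_def)
  moreover have "u < m" "v < m" if "{u, v} \<in> E" for u v
    using that m by blast+
  ultimately have "proper_colouring UNIV E (\<lambda>n. min n m)"
    unfolding proper_colouring_def by (metis min.strict_order_iff)
  moreover have "range (\<lambda>n. min n m) \<subseteq> {..<Suc m}" by auto
  ultimately show "E \<in> G_fc" using E unfolding G_fc_iff by blast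
next
  fix E F assume "E \<in> G_fc" "F \<subseteq> E"
  then obtain c :: "nat \<Rightarrow> nat" and k
    where "range c \<subseteq> {..<k}" "proper_colouring UNIV E c" "F \<subseteq> [UNIV]\<^bsup>2\<^esup>"
    unfolding G_fc_iff by (meson order_trans)
  moreover have "proper_colouring UNIV F c"
    using \<open>proper_colouring UNIV E c\<close> \<open>F \<subseteq> E\<close> unfolding proper_colouring_def by auto
  ultimately show "F \<in> G_fc" unfolding G_fc_iff by blast
next
  fix E F assume "E \<in> G_fc" "F \<in> G_fc"
  then obtain c d :: "nat \<Rightarrow> nat" and k l
    where c: "range c \<subseteq> {..<k}" "proper_colouring UNIV E c"
      and d: "range d \<subseteq> {..<l}" "proper_colouring UNIV F d"
      and EF: "E \<union> F \<subseteq> [UNIV]\<^bsup>2\<^esup>"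
    unfolding G_fc_iff by (meson Un_least)
  define e where "e n = prod_encode (c n, d n)" for n
  have "proper_colouring UNIV (E \<union> F) e"
    using c(2) d(2) by (auto simp: proper_colouring_def e_def)
  moreover have "range e \<subseteq> prod_encode ` ({..<k} \<times> {..<l})"
    using c(1) d(1) by (auto simp: e_def)
  then have "finite (range e)" by (rule finite_subset) simp
  then obtain m where "range e \<subseteq> {..<m}" using finite_nat_iff_bounded[of "range e"] by blast
  ultimately show "E \<union> F \<in> G_fc" using EF unfolding G_fc_iff by blast
qed

end

theory Submission
  imports Defs "HOL-Library.Disjoint_Sets"
begin

text \<open>
  For each \<open>k\<close> split \<open>\<omega>\<close> into consecutive intervals of length \<open>k + 1\<close>. If no \<open>A \<alpha>\<close> contains the
  cliques on infinitely many of these intervals, choose \<open>\<alpha>\<close> and \<open>s\<close> with \<open>s\<close> maximal such that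
  \<open>A \<alpha>\<close> has at least \<open>s\<close> edges in infinitely many of these cliques. Picking from each of them one
  edge outside \<open>A \<alpha>\<close> gives a pseudointersection of the complements. Otherwise there is, for every
  \<open>k\<close>, some \<open>\<alpha>\<^sub>k\<close> for which \<open>A \<alpha>\<^sub>k\<close> contains infinitely many disjoint \<open>(k + 1)\<close>-cliques. A bound
  \<open>\<beta>\<close> of all \<open>\<alpha>\<^sub>k\<close> would give \<open>A \<beta>\<close> cliques of every finite size, contradicting its finite
  chromatic number. So the \<open>\<alpha>\<^sub>k\<close> are cofinal, and diagonalizing against the \<open>A \<alpha>\<^sub>k\<close> gives a
  pseudointersection.
\<close>

lemma almost_subset_finite_Int:
  assumes "A \<subseteq>* B" "finite (X \<inter> B)"
  shows "finite (X \<inter> A)"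
proof (rule finite_subset)
  show "X \<inter> A \<subseteq> (A - B) \<union> (X \<inter> B)" by blast
  show "finite ((A - B) \<union> (X \<inter> B))" using assms by (simp add: almost_subset_def)
qed

lemma finite_indices_of_disjoint_family:
  assumes "disjoint_family Q" "finite F"
  shows "finite {i. Q i \<inter> F \<noteq> {}}"
proof -
  have "finite {i. x \<in> Q i}" for x
  proof (cases "\<exists>j. x \<in> Q j")
    case True
    then obtain j where "x \<in> Q j" by blast
    then have "{i. x \<in> Q i} \<subseteq> {j}"
      using assms(1) unfolding disjoint_family_on_def by blast
    then show ?thesis by (rule finite_subset) simp
  qed simp
  then have "finite (\<Union>x\<in>F. {i. x \<in> Q i})" using assms(2) by blast
  then show ?thesis by (rule rev_finite_subset) auto
qed

text \<open>An exceptional block must meet the finite set \<open>A - B\<close>, and each point of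
  that set lies in at most one block.\<close>

lemma almost_subset_eventually_on_disjoint_family:
  assumes "disjoint_family Q" "A \<subseteq>* B"
  shows "finite {i. \<not> Q i \<inter> A \<subseteq> B}"
  by (rule finite_subset[OF _ finite_indices_of_disjoint_family[of Q "A - B"]])
    (use assms in \<open>auto simp: almost_subset_def\<close>)

text \<open>The equal finite size of the blocks bounds the maximum \<open>s\<close>, which is taken
  over the whole chain and not just for one \<open>A\<close>. This is why a \<open>B\<close> almost
  above \<open>A\<close> cannot contain infinitely many of the points picked outside
  \<open>A\<close>.\<close>

lemma almost_disjoint_from_chain:
  fixes Q :: "nat \<Rightarrow> 'a set"
  assumes disj: "disjoint_family Q"
    and fin: "\<And>i. finite (Q i)" and card: "\<And>i. card (Q i) = N"
    and "\<A> \<noteq> {}"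
    and chain: "\<And>A B. A \<in> \<A> \<Longrightarrow> B \<in> \<A> \<Longrightarrow> A \<subseteq>* B \<or> B \<subseteq>* A"
    and not_full: "\<And>A. A \<in> \<A> \<Longrightarrow> finite {i. Q i \<subseteq> A}"
  shows "\<exists>X \<subseteq> (\<Union>i. Q i). infinite X \<and> (\<forall>A\<in>\<A>. finite (X \<inter> A))"
proof -
  define P where "P s \<longleftrightarrow> (\<exists>A\<in>\<A>. infinite {i. s \<le> card (Q i \<inter> A)})" for s
  have full_iff: "N \<le> card (Q i \<inter> A) \<longleftrightarrow> Q i \<subseteq> A" for i A
  proof
    assume "N \<le> card (Q i \<inter> A)"
    then have "Q i \<inter> A = Q i" by (intro card_seteq fin) (simp_all add: card)
    then show "Q i \<subseteq> A" by blast
  next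
    assume "Q i \<subseteq> A"
    then have "Q i \<inter> A = Q i" by blast
    then show "N \<le> card (Q i \<inter> A)" by (simp add: card)
  qed
  have P_less: "s < N" if "P s" for s
  proof (rule ccontr)
    assume "\<not> s < N"
    from that obtain A where A: "A \<in> \<A>" "infinite {i. s \<le> card (Q i \<inter> A)}"
      unfolding P_def by (elim bexE)
    have "{i. s \<le> card (Q i \<inter> A)} \<subseteq> {i. Q i \<subseteq> A}"
    proof (rule Collect_mono, rule impI)
      fix i assume "s \<le> card (Q i \<inter> A)"
      with \<open>\<not> s < N\<close> have "N \<le> card (Q i \<inter> A)" by linarith
      then show "Q i \<subseteq> A" by (simp only: full_iff)
    qed
    then show False using A not_full[OF A(1)] finite_subset by blast
  qed
  have "P 0" using \<open>\<A> \<noteq> {}\<close> by (auto simp: P_def)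
  define s where "s = Greatest P"
  have bound: "t \<le> N" if "P t" for t using P_less[OF that] by (rule less_imp_le)
  have "P s" unfolding s_def by (rule GreatestI_nat[of P, OF \<open>P 0\<close> bound])
  have "\<not> P (Suc s)"
  proof
    assume "P (Suc s)"
    then have "Suc s \<le> s" unfolding s_def by (rule Greatest_le_nat[of P, OF _ bound])
    then show False by simp
  qed
  from \<open>P s\<close> obtain A where A: "A \<in> \<A>" and "infinite {i. s \<le> card (Q i \<inter> A)}"
    unfolding P_def by blast
  \<comment> \<open>Blocks filled by \<open>A\<close> are discarded, so every remaining one offers a
    point outside \<open>A\<close>.\<close>
  then have inf: "infinite ({i. s \<le> card (Q i \<inter> A)} - {i. Q i \<subseteq> A})" (is "infinite ?D")
    using not_full[OF A] by (intro Diff_infinite_finite)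
  define e where "e i = (SOME x. x \<in> Q i - A)" for i
  have e: "e i \<in> Q i - A" if "i \<in> ?D" for i
    unfolding e_def by (rule someI_ex) (use that in blast)
  have "inj_on e ?D"
  proof (rule inj_onI)
    fix i j assume "i \<in> ?D" "j \<in> ?D" "e i = e j"
    then have "e i \<in> Q i \<inter> Q j" using e[of i] e[of j] by auto
    then show "i = j" using disj by (auto simp: disjoint_family_on_def)
  qed
  show ?thesis
  proof (intro exI[of _ "e ` ?D"] conjI ballI)
    show "e ` ?D \<subseteq> (\<Union>i. Q i)" using e by blast
    show "infinite (e ` ?D)" using inf \<open>inj_on e ?D\<close> by (simp add: finite_image_iff)
    fix B assume B: "B \<in> \<A>"
    from chain[OF A B] show "finite (e ` ?D \<inter> B)"
    proof
      assume "B \<subseteq>* A"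
      moreover have "e ` ?D \<inter> A = {}" using e by blast
      then have "finite (e ` ?D \<inter> A)" by (simp only: finite.emptyI)
      ultimately show ?thesis by (rule almost_subset_finite_Int)
    next
      assume "A \<subseteq>* B"
      \<comment> \<open>In such a block \<open>B\<close> inherits the \<open>s\<close> or more
        points of \<open>A\<close> and gains the new point \<open>e i\<close>.\<close>
      have "Suc s \<le> card (Q i \<inter> B)" if "i \<in> ?D" "e i \<in> B" "Q i \<inter> A \<subseteq> B" for i
      proof -
        have "Suc s \<le> card (insert (e i) (Q i \<inter> A))"
          using that e[OF that(1)] fin[of i] by simp
        also have "\<dots> \<le> card (Q i \<inter> B)"
          using that e[OF that(1)] fin[of i] by (intro card_mono) auto
        finally show ?thesis .
      qed
      \<comment> \<open>The first index set is finite by maximality of \<open>s\<close>, the second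
        because \<open>A \<subseteq>* B\<close>.\<close>
      then have "e ` ?D \<inter> B \<subseteq> e ` ({i. Suc s \<le> card (Q i \<inter> B)} \<union> {i. \<not> Q i \<inter> A \<subseteq> B})"
        by blast
      moreover have "finite {i. Suc s \<le> card (Q i \<inter> B)}"
        using \<open>\<not> P (Suc s)\<close> B unfolding P_def by blast
      moreover note almost_subset_eventually_on_disjoint_family[OF disj \<open>A \<subseteq>* B\<close>]
      ultimately show ?thesis
        by (rule finite_subset[OF _ finite_imageI[OF finite_UnI]])
    qed
  qed
qed

text \<open>Instead of choosing distinct points recursively, take for each \<open>n\<close> a set of
  \<open>n\<close> points outside the first \<open>n + 1\<close> sets. The union is infinite because
  its subsets \<open>F n\<close> have unbounded size, and only the \<open>F m\<close> with
  \<open>m < n\<close> can meet \<open>C n\<close>.\<close>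

lemma diagonal_almost_disjoint:
  fixes C :: "nat \<Rightarrow> 'a set"
  assumes "\<And>n. infinite (\<Omega> - (\<Union>j\<le>n. C j))"
  obtains X where "X \<subseteq> \<Omega>" "infinite X" "\<And>n. finite (X \<inter> C n)"
proof -
  have "\<exists>F. finite F \<and> card F = n \<and> F \<subseteq> \<Omega> - (\<Union>j\<le>n. C j)" for n
    using infinite_arbitrarily_large[OF assms] by blast
  then obtain F where F: "\<And>n. finite (F n)" "\<And>n. card (F n) = n"
      "\<And>n. F n \<subseteq> \<Omega> - (\<Union>j\<le>n. C j)"
    by metis
  show ?thesis
  proof (rule that[of "\<Union>n. F n"])
    show "(\<Union>n. F n) \<subseteq> \<Omega>" using F(3) by blast
    show "infinite (\<Union>n. F n)"
    proof
      assume fin: "finite (\<Union>n. F n)"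
      have "n \<le> card (\<Union>n. F n)" for n
        using card_mono[OF fin, of "F n"] F(2)[of n] by auto
      then show False using not_less_eq_eq by blast
    qed
    fix n
    have "(\<Union>m. F m) \<inter> C n \<subseteq> (\<Union>m<n. F m)"
    proof
      fix x assume "x \<in> (\<Union>m. F m) \<inter> C n"
      then obtain m where m: "x \<in> F m" "x \<in> C n" by blast
      then have "\<not> n \<le> m" using F(3)[of m] by blast
      then show "x \<in> (\<Union>m<n. F m)" using m by auto
    qed
    then show "finite ((\<Union>m. F m) \<inter> C n)"
      using F(1) by (meson finite_UN_I finite_lessThan finite_subset)
  qed
qed

lemma ideal_on_infinite_Diff:
  assumes "ideal_on \<Omega> I" "A \<in> I"
  shows "infinite (\<Omega> - A)"
proof
  assume "finite (\<Omega> - A)"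
  then have "A \<union> (\<Omega> - A) \<in> I" using assms unfolding ideal_on_def by blast
  moreover have "A \<union> (\<Omega> - A) = \<Omega>" using assms unfolding ideal_on_def by blast
  ultimately show False using assms unfolding ideal_on_def by simp
qed

lemma ideal_on_UN_atMost:
  assumes "ideal_on \<Omega> I" "\<And>j. C j \<in> I"
  shows "(\<Union>j\<le>(n::nat). C j) \<in> I"
  using assms by (induction n) (auto simp: atMost_Suc ideal_on_def)

text \<open>A proper colouring is injective on a clique.\<close>

lemma clique_card_le_colours:
  fixes c :: "nat \<Rightarrow> nat"
  assumes "range c \<subseteq> {..<k}" "proper_colouring UNIV E c" "[B]\<^bsup>2\<^esup> \<subseteq> E"
  shows "card B \<le> k"
proof -
  have "inj_on c B"
  proof (rule inj_onI, rule ccontr)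
    fix u v assume uv: "u \<in> B" "v \<in> B" "c u = c v" "u \<noteq> v"
    then have "{u, v} \<in> E" using assms(3) by (auto simp: nsets_def)
    then show False using uv(3) assms(2) by (auto simp: proper_colouring_def)
  qed
  moreover have "c ` B \<subseteq> {..<k}" using assms(1) by blast
  ultimately have "card B \<le> card {..<k}" by (intro card_inj_on_le) auto
  then show ?thesis by simp
qed

text \<open>The interval has \<open>k + 1\<close> vertices, one more than \<open>k\<close> colours
  can separate. For fixed \<open>k\<close> the blocks are pairwise disjoint sets of edges of one
  common size, as \<open>almost_disjoint_from_chain\<close> requires.\<close>

definition clique_block :: "nat \<Rightarrow> nat \<Rightarrow> nat set set" where
  "clique_block k i = [{i * Suc k..<Suc i * Suc k}]\<^bsup>2\<^esup>"

lemma disjoint_clique_block: "disjoint_family (clique_block k)"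
  unfolding disjoint_family_on_def
proof (intro ballI impI)
  fix i j :: nat assume "i \<noteq> j"
  \<comment> \<open>Division recovers the interval from any vertex, so a nonempty edge belongs to
    only one block.\<close>
  have idx: "x div Suc k = i" if "x \<in> {i * Suc k..<Suc i * Suc k}" for x i
    by (rule div_nat_eqI) (use that in \<open>simp_all only: atLeastLessThan_iff mult.commute\<close>)
  show "clique_block k i \<inter> clique_block k j = {}"
  proof (rule equals0I)
    fix e assume "e \<in> clique_block k i \<inter> clique_block k j"
    then have e: "e \<subseteq> {i * Suc k..<Suc i * Suc k}" "e \<subseteq> {j * Suc k..<Suc j * Suc k}" "card e = 2"
      unfolding clique_block_def nsets_def by blast+
    then obtain x where "x \<in> e" by fastforce
    then show False using e idx[of x i] idx[of x j] \<open>i \<noteq> j\<close> by blast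
  qed
qed

lemma card_clique_block: "card (clique_block k i) = Suc k choose 2"
  by (simp add: clique_block_def)

lemma finite_clique_block: "finite (clique_block k i)"
  by (simp add: clique_block_def finite_imp_finite_nsets)

lemma G_fc_excludes_clique_block:
  assumes "E \<in> G_fc"
  shows "\<exists>k. \<forall>i. \<not> clique_block k i \<subseteq> E"
proof -
  have "\<exists>(c :: nat \<Rightarrow> nat) k. range c \<subseteq> {..<k} \<and> proper_colouring UNIV E c"
    using assms G_fc_iff by blast
  then obtain c :: "nat \<Rightarrow> nat" and k where c: "range c \<subseteq> {..<k}" "proper_colouring UNIV E c"
    by (elim exE conjE)
  have "\<not> clique_block k i \<subseteq> E" for i
  proof
    assume "clique_block k i \<subseteq> E"
    then have "card {i * Suc k..<Suc i * Suc k} \<le> k"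
      unfolding clique_block_def by (rule clique_card_le_colours[OF c])
    then show False by simp
  qed
  then show ?thesis by (intro exI allI)
qed

theorem mainTheorem4:
  fixes \<kappa> :: "'k rel" and A :: "'k \<Rightarrow> nat set set"
  shows "\<not> cotower ([UNIV]\<^bsup>2\<^esup>) G_fc \<kappa> A"
proof
  let ?\<Omega> = "[UNIV]\<^bsup>2\<^esup> :: nat set set"
  assume cot: "cotower ?\<Omega> G_fc \<kappa> A"
  have G: "A \<alpha> \<in> G_fc" if "\<alpha> \<in> Field \<kappa>" for \<alpha>
    using cot that by (auto simp: cotower_def)
  have tot: "(\<alpha>, \<beta>) \<in> \<kappa> \<or> (\<beta>, \<alpha>) \<in> \<kappa>" if "\<alpha> \<in> Field \<kappa>" "\<beta> \<in> Field \<kappa>" for \<alpha> \<beta>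
  proof -
    have "Well_order \<kappa>"
      using cot by (auto simp: cotower_def tower_def card_order_on_well_order_on)
    then show ?thesis
      using that by (metis wo_rel.TOTALS wo_rel_def)
  qed
  have mono: "A \<alpha> \<subseteq>* A \<beta>" if "(\<alpha>, \<beta>) \<in> \<kappa>" for \<alpha> \<beta>
  proof -
    have "A \<alpha> \<subseteq> ?\<Omega>" using G[of \<alpha>] that by (auto simp: FieldI1 G_fc_def)
    then have "A \<alpha> - A \<beta> = (?\<Omega> - A \<beta>) - (?\<Omega> - A \<alpha>)" by blast
    moreover have "(?\<Omega> - A \<beta>) \<subseteq>* (?\<Omega> - A \<alpha>)"
      using cot that by (auto simp: cotower_def tower_def)
    ultimately show ?thesis by (simp add: almost_subset_def)
  qed
  have no_pseudo: "\<exists>\<alpha>\<in>Field \<kappa>. infinite (X \<inter> A \<alpha>)" if "X \<subseteq> ?\<Omega>" "infinite X" for X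
  proof (rule ccontr)
    assume fin: "\<not> ?thesis"
    have "X - (?\<Omega> - A \<alpha>) = X \<inter> A \<alpha>" for \<alpha> using that by blast
    then have "pseudointersection ?\<Omega> \<kappa> (\<lambda>\<alpha>. ?\<Omega> - A \<alpha>) X"
      using that fin by (auto simp: pseudointersection_def almost_subset_def)
    then show False using cot by (auto simp: cotower_def tower_def)
  qed
  have "\<exists>\<alpha>\<in>Field \<kappa>. infinite {i. clique_block k i \<subseteq> A \<alpha>}" for k
  proof (rule ccontr)
    assume not_full: "\<not> ?thesis"
    have "infinite ?\<Omega>"
      using ideal_on_infinite_Diff[OF ideal_on_G_fc, of "{}"] ideal_on_G_fc
      by (auto simp: ideal_on_def)
    \<comment> \<open>With no index at all, the full edge set would be a pseudointersection.\<close>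
    then have "A ` Field \<kappa> \<noteq> {}" using no_pseudo[of ?\<Omega>] by blast
    moreover have "B \<subseteq>* C \<or> C \<subseteq>* B" if "B \<in> A ` Field \<kappa>" "C \<in> A ` Field \<kappa>" for B C
      using that tot mono by blast
    moreover have "finite {i. clique_block k i \<subseteq> B}" if "B \<in> A ` Field \<kappa>" for B
      using that not_full by blast
    ultimately have "\<exists>X \<subseteq> (\<Union>i. clique_block k i).
        infinite X \<and> (\<forall>B \<in> A ` Field \<kappa>. finite (X \<inter> B))"
      by (rule almost_disjoint_from_chain[OF disjoint_clique_block finite_clique_block
          card_clique_block])
    then obtain X where "X \<subseteq> (\<Union>i. clique_block k i)" "infinite X"
        "\<forall>B \<in> A ` Field \<kappa>. finite (X \<inter> B)"
      by blast
    moreover have "(\<Union>i. clique_block k i) \<subseteq> ?\<Omega>"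
      by (auto simp: clique_block_def nsets_def)
    ultimately show False using no_pseudo[of X] by blast
  qed
  then obtain a where a: "\<And>k. a k \<in> Field \<kappa>" "\<And>k. infinite {i. clique_block k i \<subseteq> A (a k)}"
    by metis
  have cofinal: "\<exists>k. (\<beta>, a k) \<in> \<kappa>" if \<beta>: "\<beta> \<in> Field \<kappa>" for \<beta>
  proof (rule ccontr)
    assume "\<not> ?thesis"
    \<comment> \<open>By totality \<open>\<beta>\<close> lies above every \<open>a k\<close>. For
      the \<open>k\<close> excluded by the colouring of \<open>A \<beta>\<close>, each of the
      infinitely many blocks inside \<open>A (a k)\<close> then witnesses a failure of inclusion,
      which almost inclusion allows only finitely often.\<close>
    then have sub: "A (a k) \<subseteq>* A \<beta>" for k using tot[OF \<beta> a(1)] mono by blast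
    obtain k where k: "\<And>i. \<not> clique_block k i \<subseteq> A \<beta>"
      using G_fc_excludes_clique_block[OF G[OF \<beta>]] by (elim exE) blast
    then have "{i. clique_block k i \<subseteq> A (a k)} \<subseteq> {i. \<not> clique_block k i \<inter> A (a k) \<subseteq> A \<beta>}"
      by (auto simp: Int_absorb2)
    then show False
      using a(2) almost_subset_eventually_on_disjoint_family[OF disjoint_clique_block sub]
      by (meson finite_subset)
  qed
  \<comment> \<open>Finite unions stay in the ideal, and its members have infinite
    complement.\<close>
  have "infinite (?\<Omega> - (\<Union>j\<le>n. A (a j)))" for n
    by (rule ideal_on_infinite_Diff[OF ideal_on_G_fc])
      (rule ideal_on_UN_atMost[OF ideal_on_G_fc G[OF a(1)]])
  then obtain X where X: "X \<subseteq> ?\<Omega>" "infinite X" "\<And>n. finite (X \<inter> A (a n))"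
    using diagonal_almost_disjoint[of ?\<Omega> "\<lambda>n. A (a n)"] by blast
  then obtain \<beta> where "\<beta> \<in> Field \<kappa>" "infinite (X \<inter> A \<beta>)" using no_pseudo by blast
  \<comment> \<open>Some \<open>a k\<close> lies above \<open>\<beta>\<close>, so
    \<open>A \<beta> \<subseteq>* A (a k)\<close>, and \<open>X\<close> meets \<open>A (a k)\<close>
    in a finite set.\<close>
  then show False using cofinal mono almost_subset_finite_Int X(3) by blast
qed

end
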